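(* Consider constrained convex function chasing with convex action set $K\subseteq\mathbb{R}^d$ and starting point $x_0\in K$, where each request $f_t$ is $\alpha_t$-strongly convex and $\kappa\alpha_t$-smooth for some $\alpha_t>0$ and has global minimum value $\min_{x\in\mathbb{R}^d}f_t(x)=0$. Let $(x_1,\dots,x_T)$ be the points played by the Constrained Online Balanced Descent algorithm, let $(y_1,\dots,y_T)$ be an optimal offline sequence in $K$ (with $y_0=x_0$), and let $\Phi_t:=\|x_t-y_t\|_2$. With $c=2\sqrt{2\kappa}$, for each $t$, $$\|x_t-x_{t-1}\|_2+f_t(x_t)+c\,(\Phi_t-\Phi_{t-1})\le 2(2+c)\,\big(\|y_t-y_{t-1}\|_2+f_t(y_t)\big).$$ Hence the Constrained Online Balanced Descent algorithm is $2(2+c)=O(\sqrt\kappa)$-competitive.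
   Context: Constrained convex function chasing: a convex set $K\subseteq\mathbb{R}^d$ and $x_0\in K$ are fixed; non-negative convex differentiable functions $f_1,\dots,f_T:\mathbb{R}^d\to[0,\infty)$ arrive online; after seeing $f_t$ the algorithm picks $x_t\in K$; total cost $\sum_t(\|x_t-x_{t-1}\|_2+f_t(x_t))$; $OPT$ is the minimum of this over offline sequences in $K$ with $y_0=x_0$; $c$-competitive means cost at most $c\cdot OPT$ on every instance. $\alpha$-strongly convex: $f(y)-f(x)-\langle\nabla f(x),y-x\rangle\ge\frac\alpha2\|x-y\|_2^2$ for all $x,y$; $\beta$-smooth: the same quantity is $\le\frac\beta2\|x-y\|_2^2$. Constrained Online Balanced Descent: given $x_{t-1}$ and $f_t$, let $x_t$ be an optimal solution of the (nonconvex) program $\min\{f_t(x):\|x-x_{t-1}\|_2\le f_t(x),\ x\in K\}$ and play $x_t$. *)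

theory Defs
  imports "HOL-Analysis.Analysis" "HOL-Library.Landau_Symbols"
begin

definition gradient :: "(real^'d \<Rightarrow> real) \<Rightarrow> real^'d \<Rightarrow> real^'d" where
  "gradient f x = (THE D. GDERIV f x :> D)"

definition strongly_convex :: "real \<Rightarrow> (real^'d \<Rightarrow> real) \<Rightarrow> bool" where
  "strongly_convex \<alpha> f \<longleftrightarrow>
     (\<forall>x y. f y - f x - gradient f x \<bullet> (y - x) \<ge> \<alpha> / 2 * (norm (x - y))\<^sup>2)"

definition smooth :: "real \<Rightarrow> (real^'d \<Rightarrow> real) \<Rightarrow> bool" where
  "smooth \<beta> f \<longleftrightarrow>
     (\<forall>x y. f y - f x - gradient f x \<bullet> (y - x) \<le> \<beta> / 2 * (norm (x - y))\<^sup>2)"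

definition chasing_request :: "(real^'d \<Rightarrow> real) \<Rightarrow> bool" where
  "chasing_request f \<longleftrightarrow>
     (\<forall>x. 0 \<le> f x) \<and> convex_on UNIV f \<and> (\<forall>x. f differentiable (at x))"

definition well_conditioned_request :: "real \<Rightarrow> (real^'d \<Rightarrow> real) \<Rightarrow> bool" where
  "well_conditioned_request \<kappa> f \<longleftrightarrow>
     chasing_request f \<and>
     (\<exists>\<alpha>>0. strongly_convex \<alpha> f \<and> smooth (\<kappa> * \<alpha>) f) \<and>
     (\<exists>z. is_arg_min f (\<lambda>_. True) z \<and> f z = 0)"

text \<open>
  A sequence of points is a function on the naturals of which only the values at
  0, ..., T matter; likewise only the requests with index 1, ..., T matter.
\<close>

definition chasing_cost :: "nat \<Rightarrow> (nat \<Rightarrow> real^'d \<Rightarrow> real) \<Rightarrow> (nat \<Rightarrow> real^'d) \<Rightarrow> real" where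
  "chasing_cost T f x = (\<Sum>t=1..T. norm (x t - x (t - 1)) + f t (x t))"

definition feasible_seq :: "(real^'d) set \<Rightarrow> real^'d \<Rightarrow> nat \<Rightarrow> (nat \<Rightarrow> real^'d) \<Rightarrow> bool" where
  "feasible_seq K x0 T y \<longleftrightarrow> y 0 = x0 \<and> (\<forall>t\<in>{1..T}. y t \<in> K)"

definition optimal_offline ::
  "(real^'d) set \<Rightarrow> real^'d \<Rightarrow> nat \<Rightarrow> (nat \<Rightarrow> real^'d \<Rightarrow> real) \<Rightarrow> (nat \<Rightarrow> real^'d) \<Rightarrow> bool" where
  "optimal_offline K x0 T f y \<longleftrightarrow> is_arg_min (chasing_cost T f) (feasible_seq K x0 T) y"

text \<open>
  The infimum is used so that the value is meaningful even when it is not attained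
  (\<open>K\<close> need not be closed); it is the minimum whenever an optimal sequence exists.
\<close>

definition OPT :: "(real^'d) set \<Rightarrow> real^'d \<Rightarrow> nat \<Rightarrow> (nat \<Rightarrow> real^'d \<Rightarrow> real) \<Rightarrow> real" where
  "OPT K x0 T f = Inf (chasing_cost T f ` Collect (feasible_seq K x0 T))"

text \<open>
  The optimal solution need not be unique (the program is nonconvex), so an
  algorithm is represented by the relation between instances and the sequences it may play.
\<close>

definition cobd_step :: "(real^'d) set \<Rightarrow> (real^'d \<Rightarrow> real) \<Rightarrow> real^'d \<Rightarrow> real^'d \<Rightarrow> bool" where
  "cobd_step K g p q \<longleftrightarrow> is_arg_min g (\<lambda>x. norm (x - p) \<le> g x \<and> x \<in> K) q"

definition cobd_plays ::
  "(real^'d) set \<Rightarrow> real^'d \<Rightarrow> nat \<Rightarrow> (nat \<Rightarrow> real^'d \<Rightarrow> real) \<Rightarrow> (nat \<Rightarrow> real^'d) \<Rightarrow> bool" where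
  "cobd_plays K x0 T f x \<longleftrightarrow>
     x 0 = x0 \<and> (\<forall>t\<in>{1..T}. cobd_step K (f t) (x (t - 1)) (x t))"

definition competitive ::
  "(real^'d) set \<Rightarrow> real^'d \<Rightarrow> ((real^'d \<Rightarrow> real) \<Rightarrow> bool) \<Rightarrow>
   (nat \<Rightarrow> (nat \<Rightarrow> real^'d \<Rightarrow> real) \<Rightarrow> (nat \<Rightarrow> real^'d) \<Rightarrow> bool) \<Rightarrow> real \<Rightarrow> bool" where
  "competitive K x0 request plays \<rho> \<longleftrightarrow>
     (\<forall>T f x. (\<forall>t\<in>{1..T}. request (f t)) \<longrightarrow> plays T f x \<longrightarrow>
        chasing_cost T f x \<le> \<rho> * OPT K x0 T f)"

lemma GDERIV_gradient:
  assumes "f differentiable (at x)"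
  shows "GDERIV f x :> gradient f x"
proof -
  obtain f' where f': "(f has_derivative f') (at x)"
    using assms by (auto simp: differentiable_def)
  have "linear f'"
    using f' by (simp add: has_derivative_linear)
  then have "f' h = h \<bullet> adjoint f' 1" for h
    using adjoint_works[of f' h 1] by simp
  then have D: "GDERIV f x :> adjoint f' 1"
    using f' unfolding gderiv_def by (metis (no_types, lifting) ext)
  have "D' = adjoint f' 1" if "GDERIV f x :> D'" for D'
    using has_derivative_unique[OF that[unfolded gderiv_def] D[unfolded gderiv_def]]
    by (metis vector_eq_ldot)
  with D show ?thesis
    unfolding gradient_def by (metis theI)
qed

lemma cobd_step_exists:
  assumes "closed K" "p \<in> K" "chasing_request g"
  shows "\<exists>q. cobd_step K g p q"
proof -
  have cont: "continuous_on UNIV g"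
    using assms(3) by (auto simp: chasing_request_def continuous_on_eq_continuous_within
        intro: differentiable_imp_continuous_within)
  let ?S = "K \<inter> {x. norm (x - p) \<le> g x} \<inter> {x. g x \<le> g p}"
  have "closed ?S"
    using assms(1) cont by (intro closed_Int closed_Collect_le) (auto intro!: continuous_intros)
  moreover have "?S \<subseteq> cball p (g p)"
    by (auto simp: dist_norm norm_minus_commute)
  ultimately have "compact ?S"
    by (meson bounded_cball bounded_subset compact_eq_bounded_closed)
  moreover have "p \<in> ?S"
    using assms by (auto simp: chasing_request_def)
  ultimately obtain q where "q \<in> ?S" "\<forall>x\<in>?S. g q \<le> g x"
    using continuous_attains_inf[of ?S g] cont continuous_on_subset by blast
  then have "cobd_step K g p q"
    unfolding cobd_step_def is_arg_min_def by force
  then show ?thesis by blast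
qed

end

theory Submission
  imports Defs "HOL-Real_Asymp.Real_Asymp"
begin

text \<open>
  Fix one round with previous point \<open>p\<close>, played point \<open>q\<close>, offline point \<open>y\<close>, and put
  \<open>H = f q\<close>. If \<open>H \<le> 2 * f y\<close> everything is paid for by \<open>f y\<close>. Otherwise
  \<open>norm (q - p) = H\<close>, and no point of \<open>K\<close> is both cheaper than \<open>q\<close> and closer than \<open>H\<close> to \<open>p\<close>.
  With \<open>g\<close> the gradient of \<open>f\<close> at \<open>q\<close>, testing this along directions
  \<open>s *\<^sub>R (y - q) + (p - q)\<close>, which stay inside \<open>K\<close> because \<open>p\<close> and \<open>y\<close> are in \<open>K\<close>, yields
  \<open>(p - q) \<bullet> (q - y) \<ge> H * (g \<bullet> (q - y)) / norm g\<close>. Smoothness bounds \<open>norm g\<close> by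
  \<open>sqrt (2 * \<kappa> * \<alpha> * H)\<close>, strong convexity gives
  \<open>g \<bullet> (q - y) \<ge> H / 2 + \<alpha> / 2 * (norm (q - y))\<^sup>2\<close>, and AM-GM shows that the potential
  drops by at least \<open>2 * H / c\<close>, which pays for the whole step.
\<close>

section \<open>Preliminary estimates\<close>

text \<open>Serves to choose one small step size meeting several strict bounds at once.\<close>

lemma eventually_mult_less_at_right_0:
  fixes a b :: real
  assumes "a > 0"
  shows "eventually (\<lambda>e. e * b < a) (at_right 0)"
proof -
  have "((\<lambda>e. e * b) \<longlongrightarrow> 0 * b) (at_right 0)"
    by (intro tendsto_intros)
  then show ?thesis
    using assms by (auto dest: order_tendstoD(2))
qed

text \<open>Both quadratic bounds apply to the same quantity at two points at distance 1, so
  \<open>\<alpha> \<le> \<kappa> * \<alpha>\<close>.\<close>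

lemma condition_number_ge_1:
  fixes f :: "real^'d \<Rightarrow> real"
  assumes "well_conditioned_request \<kappa> f"
  shows "\<kappa> \<ge> 1"
proof -
  obtain \<alpha> where \<alpha>: "\<alpha> > 0" "strongly_convex \<alpha> f" "smooth (\<kappa> * \<alpha>) f"
    using assms by (auto simp: well_conditioned_request_def)
  let ?v = "axis undefined 1 :: real^'d"
  have "\<alpha> / 2 * (norm (0 - ?v))\<^sup>2 \<le> \<kappa> * \<alpha> / 2 * (norm (0 - ?v))\<^sup>2"
    using \<alpha>(2,3) unfolding strongly_convex_def smooth_def by (meson order_trans)
  then show ?thesis
    using \<alpha>(1) by (simp add: norm_axis_1)
qed

text \<open>A gradient step of size \<open>1 / \<beta>\<close> lowers \<open>f\<close> by at least
  the squared gradient norm over \<open>2 * \<beta>\<close>, yet the value stays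
  nonnegative.\<close>

lemma smooth_nonneg_gradient_bound:
  fixes f :: "real^'d \<Rightarrow> real"
  assumes "smooth \<beta> f" and "\<beta> > 0" and "\<And>x. 0 \<le> f x"
  shows "(norm (gradient f x))\<^sup>2 \<le> 2 * \<beta> * f x"
proof -
  let ?g = "gradient f x"
  let ?y = "x - (1 / \<beta>) *\<^sub>R ?g"
  have "f ?y - f x - ?g \<bullet> (?y - x) \<le> \<beta> / 2 * (norm (x - ?y))\<^sup>2"
    using assms(1) unfolding smooth_def by blast
  moreover have "?g \<bullet> (?y - x) = - ((norm ?g)\<^sup>2 / \<beta>)"
    by (simp add: power2_norm_eq_inner)
  moreover have "\<beta> / 2 * (norm (x - ?y))\<^sup>2 = (norm ?g)\<^sup>2 / (2 * \<beta>)"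
    using assms(2) by (simp add: power_divide power2_eq_square field_simps)
  ultimately have "(norm ?g)\<^sup>2 / \<beta> - (norm ?g)\<^sup>2 / (2 * \<beta>) \<le> f x"
    using assms(3)[of ?y] by linarith
  then show ?thesis
    using assms(2) by (simp add: field_simps)
qed

section \<open>Optimality conditions for the played point\<close>

text \<open>A cheaper \<open>x\<close> must violate the constraint, whereas \<open>p\<close>
  satisfies it. So the segment from \<open>p\<close> to \<open>x\<close> has a point where distance
  equals cost; it is feasible and costs at most \<open>norm (x - p) < f q\<close>, against
  minimality.\<close>

lemma cobd_step_no_cheaper_closer_point:
  fixes f :: "real^'d \<Rightarrow> real"
  assumes "convex K" "chasing_request f" "p \<in> K" "cobd_step K f p q"
    and "x \<in> K" "norm (x - p) < f q"
  shows "f q \<le> f x"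
proof (rule ccontr)
  assume less: "\<not> f q \<le> f x"
  have min: "f q \<le> f w" if "w \<in> K" "norm (w - p) \<le> f w" for w
    using assms(4) that by (force simp: cobd_step_def is_arg_min_def)
  have cont: "continuous_on UNIV f"
    using assms(2) by (auto simp: chasing_request_def continuous_on_eq_continuous_within
        intro: differentiable_imp_continuous_within)
  define w where "w = (\<lambda>l. p + l *\<^sub>R (x - p))"
  have dist: "norm (w l - p) = \<bar>l\<bar> * norm (x - p)" for l
    by (simp add: w_def)
  have "continuous_on {0..1} (\<lambda>l. norm (w l - p) - f (w l))"
    unfolding w_def
    by (intro continuous_intros continuous_on_compose2[OF cont]) auto
  moreover have "norm (w 0 - p) - f (w 0) \<le> 0"
    using assms(2) by (simp add: w_def chasing_request_def)
  moreover have "0 \<le> norm (w 1 - p) - f (w 1)"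
    using min[OF assms(5)] less by (cases "norm (x - p) \<le> f x") (auto simp: w_def)
  ultimately obtain l where l: "0 \<le> l" "l \<le> 1" "norm (w l - p) - f (w l) = 0"
    using IVT'[of "\<lambda>l. norm (w l - p) - f (w l)" 0 0 1] by auto
  have "w l = (1 - l) *\<^sub>R p + l *\<^sub>R x"
    by (simp add: w_def algebra_simps)
  then have "w l \<in> K"
    using assms(1,3,5) l by (simp add: convexD)
  then have "f q \<le> f (w l)"
    using min l(3) by simp
  moreover have "norm (w l - p) \<le> norm (x - p)"
    using l(1,2) by (simp add: dist mult_left_le_one_le)
  ultimately show False
    using l(3) assms(6) by linarith
qed

text \<open>With slack, moving \<open>q\<close> slightly towards \<open>y\<close> keeps the distance
  to \<open>p\<close> below \<open>f q\<close>, and by convexity lowers the cost.\<close>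

lemma cobd_step_balanced:
  fixes f :: "real^'d \<Rightarrow> real"
  assumes "convex K" "chasing_request f" "p \<in> K" "y \<in> K" "cobd_step K f p q"
    and "f y < f q"
  shows "norm (q - p) = f q"
proof (rule ccontr)
  assume "norm (q - p) \<noteq> f q"
  then have slack: "0 < f q - norm (q - p)" and qK: "q \<in> K"
    using assms(5) by (auto simp: cobd_step_def is_arg_min_def)
  have "eventually (\<lambda>e. e * norm (y - q) < f q - norm (q - p) \<and> e * 1 < 1 \<and> e > 0)
      (at_right (0::real))"
    by (intro eventually_conj eventually_mult_less_at_right_0 slack eventually_at_right_less) simp
  then obtain e :: real where e: "e * norm (y - q) < f q - norm (q - p)" "e < 1" "e > 0"
    using eventually_happens by fastforce
  let ?x = "(1 - e) *\<^sub>R q + e *\<^sub>R y"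
  have "?x \<in> K"
    using assms(1,4) qK e by (simp add: convexD)
  moreover have "?x - p = (q - p) + e *\<^sub>R (y - q)"
    by (simp add: algebra_simps)
  then have "norm (?x - p) \<le> norm (q - p) + e * norm (y - q)"
    using norm_triangle_ineq[of "q - p" "e *\<^sub>R (y - q)"] e by (metis abs_of_pos norm_scaleR)
  then have "norm (?x - p) < f q"
    using e by linarith
  ultimately have "f q \<le> f ?x"
    using cobd_step_no_cheaper_closer_point assms by blast
  also have "f ?x \<le> (1 - e) * f q + e * f y"
    using assms(2) e by (auto simp: chasing_request_def intro!: convex_onD)
  also have "\<dots> < f q"
    using assms(6) e mult_strict_left_mono[of "f y" "f q" e] by (simp add: algebra_simps)
  finally show False by simp
qed

text \<open>Otherwise a short step from \<open>q\<close> along this direction would both lower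
  \<open>f\<close> and approach \<open>p\<close>.\<close>

lemma cobd_step_descent_direction:
  fixes f :: "real^'d \<Rightarrow> real"
  assumes "convex K" "chasing_request f" "smooth \<beta> f" "p \<in> K" "y \<in> K" "cobd_step K f p q"
    and "norm (q - p) = f q" "s \<ge> 0"
    and "gradient f q \<bullet> (s *\<^sub>R (y - q) + (p - q)) < 0"
  shows "(p - q) \<bullet> (s *\<^sub>R (y - q) + (p - q)) \<le> 0"
proof (rule ccontr)
  define v where "v = s *\<^sub>R (y - q) + (p - q)"
  assume "\<not> (p - q) \<bullet> (s *\<^sub>R (y - q) + (p - q)) \<le> 0"
  then have pos: "0 < 2 * ((p - q) \<bullet> v)" and neg: "0 < - (gradient f q \<bullet> v)"
    using assms(9) by (auto simp: v_def)
  have qK: "q \<in> K"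
    using assms(6) by (auto simp: cobd_step_def is_arg_min_def)
  \<comment> \<open>The three bounds on \<open>e\<close> ensure, in turn: the new point is closer to
    \<open>p\<close>; the smoothness error stays below the first-order decrease; the new point is a
    convex combination of \<open>q\<close>, \<open>y\<close>, \<open>p\<close>.\<close>
  have "eventually (\<lambda>e. e * (norm v)\<^sup>2 < 2 * ((p - q) \<bullet> v) \<and>
      e * (\<beta> / 2 * (norm v)\<^sup>2) < - (gradient f q \<bullet> v) \<and> e * (s + 1) < 1 \<and> e > 0)
      (at_right (0::real))"
    by (intro eventually_conj eventually_mult_less_at_right_0 pos neg eventually_at_right_less) simp
  then obtain e where e: "e * (norm v)\<^sup>2 < 2 * ((p - q) \<bullet> v)"
      "e * (\<beta> / 2 * (norm v)\<^sup>2) < - (gradient f q \<bullet> v)" "e * (s + 1) < 1" "e > 0"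
    using eventually_happens by fastforce
  let ?x = "q + e *\<^sub>R v"
  have "?x = (1 - e * s - e) *\<^sub>R q + (e * s) *\<^sub>R y + e *\<^sub>R p"
    by (simp add: v_def algebra_simps)
  moreover have "(1 - e * s - e) *\<^sub>R q + (e * s) *\<^sub>R y + e *\<^sub>R p \<in> convex hull {q, y, p}"
    unfolding convex_hull_3 mem_Collect_eq using assms(8) e
    by (intro exI[of _ "1 - e * s - e"] exI[of _ "e * s"] exI[of _ e]) (auto simp: algebra_simps)
  moreover have "convex hull {q, y, p} \<subseteq> K"
    using assms(1,4,5) qK by (intro hull_minimal) auto
  ultimately have xK: "?x \<in> K" by auto
  have "(norm (?x - p))\<^sup>2 = (norm (q - p))\<^sup>2 + e * (e * (norm v)\<^sup>2 - 2 * ((p - q) \<bullet> v))"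
    by (simp add: power2_norm_eq_inner algebra_simps inner_commute)
  also have "\<dots> < (norm (q - p))\<^sup>2"
    using e by (simp add: mult_pos_neg)
  finally have "norm (?x - p) < f q"
    using assms(7) by (metis norm_ge_zero power2_less_imp_less)
  then have "f q \<le> f ?x"
    using cobd_step_no_cheaper_closer_point assms xK by blast
  moreover have "f ?x - f q - gradient f q \<bullet> (?x - q) \<le> \<beta> / 2 * (norm (q - ?x))\<^sup>2"
    using assms(3) unfolding smooth_def by blast
  then have "f ?x \<le> f q + e * (e * (\<beta> / 2 * (norm v)\<^sup>2) + gradient f q \<bullet> v)"
    by (simp add: power_mult_distrib power2_eq_square algebra_simps)
  moreover have "e * (e * (\<beta> / 2 * (norm v)\<^sup>2) + gradient f q \<bullet> v) < 0"
    using e by (intro mult_pos_neg) auto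
  ultimately show False by linarith
qed

text \<open>
  This replaces the Lagrange multiplier of \<open>f \<le> f q\<close> in the projection of \<open>p\<close> onto
  the sublevel set; \<open>p \<in> K\<close> is what makes it insensitive to the constraint \<open>K\<close>.
\<close>

lemma cobd_step_angle:
  fixes f :: "real^'d \<Rightarrow> real"
  assumes "convex K" "chasing_request f" "smooth \<beta> f" "p \<in> K" "y \<in> K" "cobd_step K f p q"
    and "norm (q - p) = f q" "gradient f q \<bullet> (q - y) > 0" "f q > 0"
  shows "f q * (gradient f q \<bullet> (q - y)) \<le> norm (gradient f q) * ((p - q) \<bullet> (q - y))"
proof -
  let ?g = "gradient f q"
  define A where "A = ?g \<bullet> (q - y)"
  define R where "R = (p - q) \<bullet> (q - y)"
  define H where "H = f q"
  have A: "A > 0" and H: "H \<ge> 0" and sq: "(p - q) \<bullet> (p - q) = H * H"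
    using assms(2,8,7)
    by (auto simp: A_def H_def chasing_request_def norm_minus_commute
        simp flip: power2_norm_eq_inner power2_eq_square)
  have g: "?g \<bullet> (p - q) \<le> norm ?g * H"
    using norm_cauchy_schwarz[of ?g "p - q"] assms(7) by (simp add: H_def norm_minus_commute)
  \<comment> \<open>By Cauchy-Schwarz, above this threshold the direction surely decreases
    \<open>f\<close>.\<close>
  have test: "H * H \<le> s * R" if "s > norm ?g * H / A" for s
  proof -
    have "norm ?g * H < s * A"
      using that A by (simp add: field_simps)
    moreover have "?g \<bullet> (s *\<^sub>R (y - q) + (p - q)) = - (s * A) + ?g \<bullet> (p - q)"
      by (simp add: A_def algebra_simps)
    ultimately have "?g \<bullet> (s *\<^sub>R (y - q) + (p - q)) < 0"
      using g by linarith
    moreover have "norm ?g * H / A \<ge> 0" using H A by simp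
    then have "s \<ge> 0" using that by linarith
    ultimately have "(p - q) \<bullet> (s *\<^sub>R (y - q) + (p - q)) \<le> 0"
      using cobd_step_descent_direction assms by blast
    moreover have "(p - q) \<bullet> (s *\<^sub>R (y - q) + (p - q)) = - (s * R) + (p - q) \<bullet> (p - q)"
      unfolding R_def by (simp add: algebra_simps)
    ultimately show ?thesis using sq by linarith
  qed
  \<comment> \<open>Strict descent excludes the threshold itself, so it is reached as a limit from
    the right.\<close>
  have "eventually (\<lambda>s. H * H \<le> s * R) (at_right (norm ?g * H / A))"
    using test by (auto simp: eventually_at_right_field intro: exI[of _ "norm ?g * H / A + 1"])
  moreover have "((\<lambda>s. s * R) \<longlongrightarrow> norm ?g * H / A * R) (at_right (norm ?g * H / A))"
    by (intro tendsto_intros)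
  ultimately have "H * H \<le> norm ?g * H / A * R"
    by (intro tendsto_lowerbound) auto
  then have "H * (H * A) \<le> H * (norm ?g * R)"
    using A by (simp add: field_simps)
  then show ?thesis
    using assms(9) by (simp add: A_def R_def H_def)
qed

section \<open>Amortized analysis of one round\<close>

lemma cobd_step_potential_drop:
  fixes f :: "real^'d \<Rightarrow> real"
  assumes "convex K" "well_conditioned_request \<kappa> f" "p \<in> K" "y \<in> K" "cobd_step K f p q"
    and "2 * f y < f q"
  shows "2 * f q \<le> 2 * sqrt (2 * \<kappa>) * (norm (p - y) - norm (q - y))"
proof -
  have req: "chasing_request f" and nonneg: "\<And>x. 0 \<le> f x"
    using assms(2) by (auto simp: well_conditioned_request_def chasing_request_def)
  obtain \<alpha> where \<alpha>: "\<alpha> > 0" "strongly_convex \<alpha> f" "smooth (\<kappa> * \<alpha>) f"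
    using assms(2) by (auto simp: well_conditioned_request_def)
  have \<kappa>: "\<kappa> \<ge> 1"
    using condition_number_ge_1 assms(2) by blast
  let ?g = "gradient f q"
  define c where "c = 2 * sqrt (2 * \<kappa>)"
  have c: "c \<ge> 0" using \<kappa> by (simp add: c_def)
  define H where "H = f q"
  define A where "A = ?g \<bullet> (q - y)"
  define R where "R = (p - q) \<bullet> (q - y)"
  define d where "d = norm (q - y)"
  define G where "G = norm ?g"
  define P where "P = norm (p - y) - d"
  have H: "H > 0" and ylt: "f y < f q"
    using nonneg[of y] assms(6) by (auto simp: H_def)
  then have d: "d > 0"
    by (auto simp: d_def)
  have "f y - f q - ?g \<bullet> (y - q) \<ge> \<alpha> / 2 * (norm (q - y))\<^sup>2"
    using \<alpha>(2) unfolding strongly_convex_def by blast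
  \<comment> \<open>The term \<open>H / 2\<close> is what \<open>2 * f y < f q\<close> leaves of
    \<open>f q - f y\<close>.\<close>
  then have A_ge: "A \<ge> H / 2 + \<alpha> / 2 * d\<^sup>2"
    using assms(6) by (simp add: A_def H_def d_def inner_diff_right)
  have "\<alpha> / 2 * d\<^sup>2 > 0" using \<alpha>(1) d by simp
  then have A: "A > 0" using A_ge H by linarith
  have G: "G > 0"
    using A by (auto simp: A_def G_def)
  have "norm (q - p) = f q"
    using cobd_step_balanced[OF assms(1) req assms(3,4,5) ylt] .
  then have angle: "H * A \<le> G * R"
    using cobd_step_angle[OF assms(1) req \<alpha>(3) assms(3,4,5)] A H
    by (simp add: H_def A_def R_def G_def)
  \<comment> \<open>Splitting \<open>p - y\<close> at \<open>q\<close> and applying Cauchy-Schwarz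
    turns the angle bound into one on the potential drop \<open>P\<close>.\<close>
  have "R + d\<^sup>2 = (p - y) \<bullet> (q - y)"
    by (simp add: R_def d_def power2_norm_eq_inner algebra_simps)
  also have "\<dots> \<le> norm (p - y) * d"
    unfolding d_def by (rule norm_cauchy_schwarz)
  finally have R: "R \<le> P * d"
    by (simp add: P_def power2_eq_square algebra_simps)
  have "G\<^sup>2 \<le> 2 * (\<kappa> * \<alpha>) * H"
    unfolding G_def H_def using smooth_nonneg_gradient_bound[OF \<alpha>(3)] \<alpha>(1) \<kappa> nonneg by simp
  then have "4 * (G\<^sup>2 * d\<^sup>2) \<le> 4 * (2 * (\<kappa> * \<alpha>) * H * d\<^sup>2)"
    by (intro mult_left_mono mult_right_mono) auto
  also have "\<dots> = 8 * \<kappa> * (H * \<alpha> * d\<^sup>2)"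
    by simp
  \<comment> \<open>AM-GM for the two summands in the lower bound on \<open>A\<close>.\<close>
  also have "H * \<alpha> * d\<^sup>2 \<le> (H / 2 + \<alpha> / 2 * d\<^sup>2)\<^sup>2"
    using zero_le_power2[of "H / 2 - \<alpha> / 2 * d\<^sup>2"] by (simp add: power2_eq_square algebra_simps)
  also have "\<dots> \<le> A\<^sup>2"
    using A_ge H \<alpha>(1) by (intro power_mono) auto
  finally have "(2 * G * d)\<^sup>2 \<le> 8 * \<kappa> * A\<^sup>2"
    using \<kappa> by (simp add: power_mult_distrib)
  \<comment> \<open>The value of \<open>c\<close> is chosen to make
    \<open>c * c = 8 * \<kappa>\<close>.\<close>
  also have "\<dots> = (c * A)\<^sup>2"
    using \<kappa> by (simp add: c_def power_mult_distrib)
  finally have cA: "2 * G * d \<le> c * A"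
    by (rule power2_le_imp_le) (use c A in simp)
  have "(G * d) * (2 * H) \<le> H * (c * A)"
    using mult_left_mono[OF cA, of H] H by (simp add: mult_ac)
  also have "\<dots> \<le> c * (G * R)"
    using mult_left_mono[OF angle c] by (simp add: mult_ac)
  also have "\<dots> \<le> c * (G * (P * d))"
    using R c G by (intro mult_left_mono) auto
  finally have "(G * d) * (2 * H) \<le> (G * d) * (c * P)"
    by (simp add: mult_ac)
  then show ?thesis
    using G d by (simp add: c_def P_def d_def H_def)
qed

text \<open>Here \<open>y'\<close> is the previous offline point. The potential is first compared
  with the offline point held at \<open>y\<close>; its move from \<open>y'\<close> then adds at most
  \<open>c * norm (y - y')\<close>.\<close>

lemma cobd_step_amortized:
  fixes f :: "real^'d \<Rightarrow> real"
  assumes "convex K" "well_conditioned_request \<kappa> f" "p \<in> K" "y \<in> K" "cobd_step K f p q"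
    and c: "c = 2 * sqrt (2 * \<kappa>)"
  shows "norm (q - p) + f q + c * (norm (q - y) - norm (p - y'))
    \<le> 2 * (2 + c) * (norm (y - y') + f y)"
proof -
  have c0: "c \<ge> 0"
    using condition_number_ge_1[OF assms(2)] c by simp
  have y0: "0 \<le> f y"
    using assms(2) by (auto simp: well_conditioned_request_def chasing_request_def)
  have M: "norm (q - p) \<le> f q"
    using assms(5) by (auto simp: cobd_step_def is_arg_min_def)
  have "norm (q - p) + f q + c * (norm (q - y) - norm (p - y)) \<le> 2 * (2 + c) * f y"
  proof (cases "f q \<le> 2 * f y")
    case True
    \<comment> \<open>The step costs at most \<open>4 * f y\<close> and raises the distance to
      \<open>y\<close> by at most \<open>2 * f y\<close>, whence the factor
      \<open>4 + 2 * c\<close>.\<close>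
    have "norm (q - y) - norm (p - y) \<le> 2 * f y"
      using norm_triangle_ineq2[of "q - y" "p - y"] M True by simp
    then have "c * (norm (q - y) - norm (p - y)) \<le> c * (2 * f y)"
      using c0 by (rule mult_left_mono)
    then show ?thesis
      using M True by (simp add: algebra_simps)
  next
    case False
    then have "2 * f q \<le> c * (norm (p - y) - norm (q - y))"
      using cobd_step_potential_drop[OF assms(1-5)] c by simp
    moreover have "0 \<le> 2 * (2 + c) * f y"
      using c0 y0 by simp
    ultimately show ?thesis
      using M by (simp add: algebra_simps)
  qed
  moreover have "norm (p - y) \<le> norm (p - y') + norm (y - y')"
    using norm_triangle_ineq4[of "p - y'" "y - y'"] by simp
  then have "c * norm (p - y) \<le> c * (norm (p - y') + norm (y - y'))"
    using c0 by (rule mult_left_mono)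
  moreover have "c * norm (y - y') \<le> 2 * (2 + c) * norm (y - y')"
    using c0 by (intro mult_right_mono) auto
  ultimately show ?thesis
    by (simp add: algebra_simps)
qed

section \<open>Summation over rounds and competitiveness\<close>

lemma cobd_plays_amortized:
  fixes f :: "nat \<Rightarrow> real^'d \<Rightarrow> real"
  assumes "convex K" "x0 \<in> K" "c = 2 * sqrt (2 * \<kappa>)"
    and "\<forall>t\<in>{1..T}. well_conditioned_request \<kappa> (f t)"
    and "cobd_plays K x0 T f x" "feasible_seq K x0 T y" "t \<in> {1..T}"
  shows "norm (x t - x (t - 1)) + f t (x t) + c * (norm (x t - y t) - norm (x (t - 1) - y (t - 1)))
    \<le> 2 * (2 + c) * (norm (y t - y (t - 1)) + f t (y t))"
proof (rule cobd_step_amortized[OF assms(1)])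
  show "x (t - 1) \<in> K"
  proof (cases "t = 1")
    case True
    then show ?thesis using assms(2,5) by (simp add: cobd_plays_def)
  next
    case False
    then have "t - 1 \<in> {1..T}" using assms(7) by auto
    then show ?thesis
      using assms(5) by (auto simp: cobd_plays_def cobd_step_def is_arg_min_def)
  qed
qed (use assms in \<open>auto simp: cobd_plays_def feasible_seq_def\<close>)

text \<open>The potential telescopes, starting at 0 since both sequences start at \<open>x0\<close>
  and ending nonnegative. Any feasible \<open>y\<close> is allowed because \<open>OPT\<close> is an
  infimum.\<close>

lemma cobd_plays_cost_le:
  fixes f :: "nat \<Rightarrow> real^'d \<Rightarrow> real"
  assumes "convex K" "x0 \<in> K" "c = 2 * sqrt (2 * \<kappa>)" "c \<ge> 0"
    and "\<forall>t\<in>{1..T}. well_conditioned_request \<kappa> (f t)"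
    and "cobd_plays K x0 T f x" "feasible_seq K x0 T y"
  shows "chasing_cost T f x \<le> 2 * (2 + c) * chasing_cost T f y"
proof -
  define \<Phi> where "\<Phi> = (\<lambda>t. norm (x t - y t))"
  have "(\<Sum>t=1..T. norm (x t - x (t - 1)) + f t (x t) + c * (\<Phi> t - \<Phi> (t - 1)))
      \<le> (\<Sum>t=1..T. 2 * (2 + c) * (norm (y t - y (t - 1)) + f t (y t)))"
    unfolding \<Phi>_def using cobd_plays_amortized assms by (intro sum_mono) blast
  moreover have "(\<Sum>t=1..T. \<Phi> t - \<Phi> (t - 1)) = \<Phi> T - \<Phi> 0"
    using sum_telescope''[of 0 T \<Phi>] by (simp add: atLeastSucAtMost_greaterThanAtMost)
  moreover have "\<Phi> 0 = 0"
    using assms(6,7) by (simp add: \<Phi>_def cobd_plays_def feasible_seq_def)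
  moreover have "0 \<le> c * \<Phi> T"
    using assms(4) by (simp add: \<Phi>_def)
  ultimately show ?thesis
    by (simp add: chasing_cost_def sum.distrib flip: sum_distrib_left)
qed

lemma cobd_competitive:
  fixes K :: "(real^'d) set"
  assumes "convex K" "x0 \<in> K" "c = 2 * sqrt (2 * \<kappa>)"
  shows "competitive K x0 (well_conditioned_request \<kappa>) (cobd_plays K x0) (2 * (2 + c))"
  unfolding competitive_def
proof (intro allI impI)
  fix T and f :: "nat \<Rightarrow> real^'d \<Rightarrow> real" and x
  assume f: "\<forall>t\<in>{1..T}. well_conditioned_request \<kappa> (f t)" and x: "cobd_plays K x0 T f x"
  have ne: "feasible_seq K x0 T (\<lambda>_. x0)"
    using assms(2) by (simp add: feasible_seq_def)
  show "chasing_cost T f x \<le> 2 * (2 + c) * OPT K x0 T f"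
  \<comment> \<open>Without a request nothing forces \<open>\<kappa> \<ge> 1\<close>, so
    \<open>c\<close> may be negative; but then both costs are 0.\<close>
  proof (cases "T = 0")
    case True
    have "chasing_cost T f ` Collect (feasible_seq K x0 T) = {0}"
      using ne True by (auto simp: chasing_cost_def)
    then show ?thesis
      using True by (simp add: OPT_def chasing_cost_def)
  next
    case False
    then have "\<kappa> \<ge> 1"
      using f condition_number_ge_1[of \<kappa> "f 1"] by simp
    then have c: "c \<ge> 0"
      using assms(3) by simp
    have "chasing_cost T f x / (2 * (2 + c)) \<le> OPT K x0 T f"
      unfolding OPT_def
    proof (rule cINF_greatest)
      fix y assume "y \<in> Collect (feasible_seq K x0 T)"
      then show "chasing_cost T f x / (2 * (2 + c)) \<le> chasing_cost T f y"
        using cobd_plays_cost_le[OF assms c f x] c by (simp add: field_simps)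
    qed (use ne in auto)
    then show ?thesis
      using c by (simp add: field_simps)
  qed
qed

theorem theorem10:
  fixes K :: "(real^'d) set" and x0 :: "real^'d" and \<kappa> c :: real
  assumes "convex K" and "x0 \<in> K" and "c = 2 * sqrt (2 * \<kappa>)"
  shows "(\<forall>T f x y.
            (\<forall>t\<in>{1..T}. well_conditioned_request \<kappa> (f t)) \<longrightarrow>
            cobd_plays K x0 T f x \<longrightarrow>
            optimal_offline K x0 T f y \<longrightarrow>
            (let \<Phi> = (\<lambda>t. norm (x t - y t)) in
              \<forall>t\<in>{1..T}.
                norm (x t - x (t - 1)) + f t (x t) + c * (\<Phi> t - \<Phi> (t - 1))
                  \<le> 2 * (2 + c) * (norm (y t - y (t - 1)) + f t (y t))))
         \<and> competitive K x0 (well_conditioned_request \<kappa>) (cobd_plays K x0) (2 * (2 + c))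
         \<and> (\<lambda>k::real. 2 * (2 + 2 * sqrt (2 * k))) \<in> O(\<lambda>k. sqrt k)"
proof (intro conjI)
  show "(\<lambda>k::real. 2 * (2 + 2 * sqrt (2 * k))) \<in> O(\<lambda>k. sqrt k)"
    by real_asymp
qed (use cobd_plays_amortized[OF assms] cobd_competitive[OF assms] in
    \<open>auto simp: Let_def optimal_offline_def is_arg_min_def\<close>)

end
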